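(* The satisfiability problem of spatial MLSL is undecidable: there is no algorithm that, given a spatial MLSL formula $\varphi$, decides whether there exist a traffic snapshot $\mathcal{T}$, a view $V=(L,X,E)$, sensor functions and a valuation $\nu$ with $\nu(\mathit{ego})=E$ such that $\mathcal{T},V,\nu\models\varphi$.
   Context: Fix a countably infinite set $\mathbb{I}$ of car identifiers and lanes $\mathbb{L}=\{0,\dots,N\}$, $N\ge1$. A traffic snapshot is $\mathcal{T}=(\mathit{res},\mathit{clm},\mathit{pos},\mathit{spd},\mathit{acc})$ with $\mathit{res},\mathit{clm}:\mathbb{I}\to\mathcal{P}(\mathbb{L})$ and $\mathit{pos},\mathit{spd},\mathit{acc}:\mathbb{I}\to\mathbb{R}$ satisfying for all $C$: $\mathit{res}(C)\cap\mathit{clm}(C)=\emptyset$; $1\le|\mathit{res}(C)|\le2$; $|\mathit{clm}(C)|\le1$; $1\le|\mathit{res}(C)|+|\mathit{clm}(C)|\le2$; if $\mathit{clm}(C)\ne\emptyset$ then $\mathit{res}(C)\cup\mathit{clm}(C)=\{n,n+1\}$ for some $n\in\mathbb{L}$; and $|\mathit{res}(C)|=2$ or $|\mathit{clm}(C)|=1$ for only finitely many $C$. A view is $V=(L,X,E)$ with $L\subseteq\mathbb{L}$ a discrete interval (possibly empty), $X=[r,t]\subseteq\mathbb{R}$, $E\in\mathbb{I}$. A sensor function $\Omega_E:\mathbb{I}\times\{\text{snapshots}\}\to\mathbb{R}_+$ gives the length of each car as perceived by $E$. Define $\mathit{res}_V(C)=\mathit{res}(C)\cap L$, $\mathit{clm}_V(C)=\mathit{clm}(C)\cap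 L$, $\mathit{len}_V(C)=[\mathit{pos}(C),\mathit{pos}(C)+\Omega_E(C,\mathcal{T})]\cap X$. For discrete intervals, $I^1\ominus I^2=I$ iff $I^1\cup I^2=I$, $I^1\cap I^2=\emptyset$ and both are discrete convex intervals (so $\max I^1+1=\min I^2$ or one is empty). Vertical chop: $V_1\ominus V_2=V$ iff $V=(L,X,E)$, $L_1\ominus L_2=L$, $V_i=(L_i,X,E)$. Horizontal chop: $V=(L,[r,t],E)$ and some $s\in[r,t]$ with $V_1=(L,[r,s],E)$, $V_2=(L,[s,t],E)$. Spatial MLSL syntax: variables of three sorts (cars, reals, lanes), a constant $\mathit{ego}$; terms $\theta::=n\mid r\mid\mathit{ego}\mid u\mid\ell\mid\omega\mid\theta_1+\theta_2$ ($n\in\mathbb{L}$, $r\in\mathbb{R}$, $u$ a variable, $+$ only between terms of the same non-car sort); formulas $\varphi::=\bot\mid\theta_1=\theta_2\mid\mathit{re}(c)\mid\mathit{cl}(c)\mid\varphi_1\to\varphi_2\mid\forall z\,\varphi\mid\varphi_1\frown\varphi_2\mid\begin{array}{c}\varphi_2\\\varphi_1\end{array}$ ($c$ a car variable or $\mathit{ego}$). Semantics w.r.t. $\mathcal{T}$, $V=(L,X,E)$, sort-respecting valuation $\nu$ with $\nu(\mathit{ego})=E$; $\nu_V(\ell)=t-r$ where $X=[r,t]$, $\nu_V(\omega)=|L|$, $+$ is addition: $\bot$ never holds; $\theta_1=\theta_2$ iff $\nu_V(\theta_1)=\nu_V(\theta_2)$; $\mathit{re}(c)$ iff $|L|=1$,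 $t-r>0$, $\mathit{res}_V(\nu(c))=L$ and $X=\mathit{len}_V(\nu(c))$; $\mathit{cl}(c)$ iff the same with $\mathit{clm}_V$; $\to$ and $\forall$ classical (quantifier over the sort of $z$); $\varphi_1\frown\varphi_2$ iff there is a horizontal chop $V_1\ominus V_2=V$ with $\mathcal{T},V_1,\nu\models\varphi_1$ and $\mathcal{T},V_2,\nu\models\varphi_2$; the vertical chop formula (with $\varphi_1$ below, $\varphi_2$ above) iff there is a vertical chop $V_1\ominus V_2=V$ with $\mathcal{T},V_1,\nu\models\varphi_1$ and $\mathcal{T},V_2,\nu\models\varphi_2$. *)

theory Defs
  imports Complex_Main "HOL-Library.Nat_Bijection" "HOL-Library.Countable_Set"
begin

section \<open>Traffic snapshots, views and sensor functions\<close>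

text \<open>Car identifiers are the elements of a type \<open>'i\<close>; lanes are \<open>{0..N}\<close>.\<close>

record 'i snapshot =
  res :: "'i \<Rightarrow> nat set"
  clm :: "'i \<Rightarrow> nat set"
  pos :: "'i \<Rightarrow> real"
  spd :: "'i \<Rightarrow> real"
  acc :: "'i \<Rightarrow> real"

definition traffic_snapshot :: "nat \<Rightarrow> 'i snapshot \<Rightarrow> bool" where
  "traffic_snapshot N T \<longleftrightarrow>
     (\<forall>C. res T C \<subseteq> {0..N} \<and> clm T C \<subseteq> {0..N} \<and>
          res T C \<inter> clm T C = {} \<and>
          1 \<le> card (res T C) \<and> card (res T C) \<le> 2 \<and>
          card (clm T C) \<le> 1 \<and>
          1 \<le> card (res T C) + card (clm T C) \<and> card (res T C) + card (clm T C) \<le> 2 \<and>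
          (clm T C \<noteq> {} \<longrightarrow> (\<exists>n\<in>{0..N}. res T C \<union> clm T C = {n, n + 1}))) \<and>
     finite {C. card (res T C) = 2 \<or> card (clm T C) = 1}"

text \<open>\<open>\<Omega> E C T\<close> is the length of car \<open>C\<close> in \<open>T\<close> as perceived by \<open>E\<close>.\<close>

type_synonym 'i sensors = "'i \<Rightarrow> 'i \<Rightarrow> 'i snapshot \<Rightarrow> real"

definition sensor_functions :: "nat \<Rightarrow> 'i sensors \<Rightarrow> bool" where
  "sensor_functions N \<Omega> \<longleftrightarrow> (\<forall>E C T. traffic_snapshot N T \<longrightarrow> 0 < \<Omega> E C T)"

text \<open>The extension \<open>X = [r, t]\<close> of a view is stored through its end points.\<close>

record 'i view =
  lanes :: "nat set"
  left :: real
  right :: real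
  owner :: 'i

definition extension :: "'i view \<Rightarrow> real set" where
  "extension V = {left V..right V}"

definition discrete_interval :: "nat set \<Rightarrow> bool" where
  "discrete_interval I \<longleftrightarrow> (\<exists>m n. I = {m..n})"

definition is_view :: "nat \<Rightarrow> 'i view \<Rightarrow> bool" where
  "is_view N V \<longleftrightarrow> lanes V \<subseteq> {0..N} \<and> discrete_interval (lanes V) \<and> left V \<le> right V"

definition res_in :: "'i snapshot \<Rightarrow> 'i view \<Rightarrow> 'i \<Rightarrow> nat set" where
  "res_in T V C = res T C \<inter> lanes V"

definition clm_in :: "'i snapshot \<Rightarrow> 'i view \<Rightarrow> 'i \<Rightarrow> nat set" where
  "clm_in T V C = clm T C \<inter> lanes V"

definition len_in :: "'i sensors \<Rightarrow> 'i snapshot \<Rightarrow> 'i view \<Rightarrow> 'i \<Rightarrow> real set" where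
  "len_in \<Omega> T V C = {pos T C..pos T C + \<Omega> (owner V) C T} \<inter> extension V"

definition interval_chop :: "nat set \<Rightarrow> nat set \<Rightarrow> nat set \<Rightarrow> bool" where
  "interval_chop I\<^sub>1 I\<^sub>2 I \<longleftrightarrow>
     I\<^sub>1 \<union> I\<^sub>2 = I \<and> I\<^sub>1 \<inter> I\<^sub>2 = {} \<and> discrete_interval I\<^sub>1 \<and> discrete_interval I\<^sub>2 \<and>
     (I\<^sub>1 = {} \<or> I\<^sub>2 = {} \<or> Max I\<^sub>1 + 1 = Min I\<^sub>2)"

definition vertical_chop :: "'i view \<Rightarrow> 'i view \<Rightarrow> 'i view \<Rightarrow> bool" where
  "vertical_chop V\<^sub>1 V\<^sub>2 V \<longleftrightarrow>
     (\<exists>L\<^sub>1 L\<^sub>2. interval_chop L\<^sub>1 L\<^sub>2 (lanes V) \<and> V\<^sub>1 = V\<lparr>lanes := L\<^sub>1\<rparr> \<and> V\<^sub>2 = V\<lparr>lanes := L\<^sub>2\<rparr>)"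

definition horizontal_chop :: "'i view \<Rightarrow> 'i view \<Rightarrow> 'i view \<Rightarrow> bool" where
  "horizontal_chop V\<^sub>1 V\<^sub>2 V \<longleftrightarrow>
     (\<exists>s\<in>{left V..right V}. V\<^sub>1 = V\<lparr>right := s\<rparr> \<and> V\<^sub>2 = V\<lparr>left := s\<rparr>)"

section \<open>Syntax\<close>

datatype srt = CarSort | RealSort | LaneSort

datatype sym = Ego | Var srt nat

text \<open>
  The type \<open>'k\<close> is the type of real constants. The formulas of spatial MLSL proper are those
  of type \<open>real fm\<close>. The instance \<open>nat fm\<close>, where real constants are replaced by names, provides
  finite representations that can serve as input of an algorithm: for a notation system
  \<open>\<rho> :: nat \<Rightarrow> real\<close>, \<open>\<phi> :: nat fm\<close> denotes the formula \<open>map_fm \<rho> \<phi> :: real fm\<close>.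
\<close>

datatype 'k trm =
    LaneConst nat
  | RealConst 'k
  | Sym sym
  | Length
  | Width
  | Plus "'k trm" "'k trm"

datatype 'k fm =
    Bot
  | Eq "'k trm" "'k trm"
  | Re sym
  | Cl sym
  | Imp "'k fm" "'k fm"
  | All srt nat "'k fm"
  | HChop "'k fm" "'k fm"
  | VChop "'k fm" "'k fm"  \<comment> \<open>lower part first\<close>

fun sort_of_sym :: "sym \<Rightarrow> srt" where
  "sort_of_sym Ego = CarSort"
| "sort_of_sym (Var s x) = s"

fun sort_of :: "'k trm \<Rightarrow> srt" where
  "sort_of (LaneConst n) = LaneSort"
| "sort_of (RealConst r) = RealSort"
| "sort_of (Sym c) = sort_of_sym c"
| "sort_of Length = RealSort"
| "sort_of Width = LaneSort"
| "sort_of (Plus a b) = sort_of a"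

fun wf_trm :: "nat \<Rightarrow> 'k trm \<Rightarrow> bool" where
  "wf_trm N (LaneConst n) \<longleftrightarrow> n \<in> {0..N}"
| "wf_trm N (RealConst r) \<longleftrightarrow> True"
| "wf_trm N (Sym c) \<longleftrightarrow> True"
| "wf_trm N Length \<longleftrightarrow> True"
| "wf_trm N Width \<longleftrightarrow> True"
| "wf_trm N (Plus a b) \<longleftrightarrow>
     wf_trm N a \<and> wf_trm N b \<and> sort_of a = sort_of b \<and> sort_of a \<noteq> CarSort"

fun wf_fm :: "nat \<Rightarrow> 'k fm \<Rightarrow> bool" where
  "wf_fm N Bot \<longleftrightarrow> True"
| "wf_fm N (Eq a b) \<longleftrightarrow> wf_trm N a \<and> wf_trm N b"
| "wf_fm N (Re c) \<longleftrightarrow> sort_of_sym c = CarSort"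
| "wf_fm N (Cl c) \<longleftrightarrow> sort_of_sym c = CarSort"
| "wf_fm N (Imp \<phi> \<psi>) \<longleftrightarrow> wf_fm N \<phi> \<and> wf_fm N \<psi>"
| "wf_fm N (All s x \<phi>) \<longleftrightarrow> wf_fm N \<phi>"
| "wf_fm N (HChop \<phi> \<psi>) \<longleftrightarrow> wf_fm N \<phi> \<and> wf_fm N \<psi>"
| "wf_fm N (VChop \<phi> \<psi>) \<longleftrightarrow> wf_fm N \<phi> \<and> wf_fm N \<psi>"

section \<open>Semantics\<close>

text \<open>
  Lanes and real numbers share the value constructor \<open>NumVal\<close>, so that an equation between a
  term of lane sort and a term of real sort compares numbers. The lane sort ranges over
  \<open>{0..N}\<close> only, but the value of \<open>Width\<close> or of a sum may exceed \<open>N\<close>.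
\<close>

datatype 'i val = CarVal 'i | NumVal real

fun sort_values :: "nat \<Rightarrow> srt \<Rightarrow> 'i val set" where
  "sort_values N CarSort = range CarVal"
| "sort_values N RealSort = range NumVal"
| "sort_values N LaneSort = (\<lambda>n. NumVal (real n)) ` {0..N}"

type_synonym 'i valuation = "sym \<Rightarrow> 'i val"

definition sort_respecting :: "nat \<Rightarrow> 'i valuation \<Rightarrow> bool" where
  "sort_respecting N \<nu> \<longleftrightarrow> (\<forall>c. \<nu> c \<in> sort_values N (sort_of_sym c))"

fun num_of :: "'i val \<Rightarrow> real" where
  "num_of (NumVal a) = a"
| "num_of (CarVal C) = undefined"

fun trm_val :: "'i view \<Rightarrow> 'i valuation \<Rightarrow> real trm \<Rightarrow> 'i val" where
  "trm_val V \<nu> (LaneConst n) = NumVal (real n)"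
| "trm_val V \<nu> (RealConst r) = NumVal r"
| "trm_val V \<nu> (Sym c) = \<nu> c"
| "trm_val V \<nu> Length = NumVal (right V - left V)"
| "trm_val V \<nu> Width = NumVal (real (card (lanes V)))"
| "trm_val V \<nu> (Plus a b) = NumVal (num_of (trm_val V \<nu> a) + num_of (trm_val V \<nu> b))"

fun models :: "nat \<Rightarrow> 'i sensors \<Rightarrow> 'i snapshot \<Rightarrow> 'i view \<Rightarrow> 'i valuation \<Rightarrow> real fm \<Rightarrow> bool" where
  "models N \<Omega> T V \<nu> Bot \<longleftrightarrow> False"
| "models N \<Omega> T V \<nu> (Eq a b) \<longleftrightarrow> trm_val V \<nu> a = trm_val V \<nu> b"
| "models N \<Omega> T V \<nu> (Re c) \<longleftrightarrow>
     (\<exists>C. \<nu> c = CarVal C \<and> card (lanes V) = 1 \<and> right V - left V > 0 \<and>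
          res_in T V C = lanes V \<and> extension V = len_in \<Omega> T V C)"
| "models N \<Omega> T V \<nu> (Cl c) \<longleftrightarrow>
     (\<exists>C. \<nu> c = CarVal C \<and> card (lanes V) = 1 \<and> right V - left V > 0 \<and>
          clm_in T V C = lanes V \<and> extension V = len_in \<Omega> T V C)"
| "models N \<Omega> T V \<nu> (Imp \<phi> \<psi>) \<longleftrightarrow> (models N \<Omega> T V \<nu> \<phi> \<longrightarrow> models N \<Omega> T V \<nu> \<psi>)"
| "models N \<Omega> T V \<nu> (All s x \<phi>) \<longleftrightarrow>
     (\<forall>a\<in>sort_values N s. models N \<Omega> T V (\<nu>(Var s x := a)) \<phi>)"
| "models N \<Omega> T V \<nu> (HChop \<phi> \<psi>) \<longleftrightarrow>
     (\<exists>V\<^sub>1 V\<^sub>2. horizontal_chop V\<^sub>1 V\<^sub>2 V \<and> models N \<Omega> T V\<^sub>1 \<nu> \<phi> \<and> models N \<Omega> T V\<^sub>2 \<nu> \<psi>)"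
| "models N \<Omega> T V \<nu> (VChop \<phi> \<psi>) \<longleftrightarrow>
     (\<exists>V\<^sub>1 V\<^sub>2. vertical_chop V\<^sub>1 V\<^sub>2 V \<and> models N \<Omega> T V\<^sub>1 \<nu> \<phi> \<and> models N \<Omega> T V\<^sub>2 \<nu> \<psi>)"

definition satisfiable :: "'i itself \<Rightarrow> nat \<Rightarrow> real fm \<Rightarrow> bool" where
  "satisfiable _ N \<phi> \<longleftrightarrow>
     (\<exists>(T :: 'i snapshot) V \<Omega> \<nu>.
        traffic_snapshot N T \<and> is_view N V \<and> sensor_functions N \<Omega> \<and>
        sort_respecting N \<nu> \<and> \<nu> Ego = CarVal (owner V) \<and> models N \<Omega> T V \<nu> \<phi>)"

section \<open>Algorithms\<close>

text \<open>
  Algorithms are Kleene's partial recursive functions; \<open>computes f xs y\<close> means that \<open>f\<close>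
  terminates on the arguments \<open>xs\<close> with result \<open>y\<close>.
\<close>

datatype recf =
    Zero
  | Succ
  | Proj nat
  | Comp recf "recf list"
  | PrimRec recf recf
  | Mu recf

inductive computes :: "recf \<Rightarrow> nat list \<Rightarrow> nat \<Rightarrow> bool" where
  computes_Zero: "computes Zero xs 0"
| computes_Succ: "computes Succ [x] (Suc x)"
| computes_Proj: "i < length xs \<Longrightarrow> computes (Proj i) xs (xs ! i)"
| computes_Comp:
    "length ys = length gs \<Longrightarrow> (\<And>i. i < length gs \<Longrightarrow> computes (gs ! i) xs (ys ! i)) \<Longrightarrow>
     computes f ys y \<Longrightarrow> computes (Comp f gs) xs y"
| computes_PrimRec_0: "computes f xs y \<Longrightarrow> computes (PrimRec f g) (0 # xs) y"
| computes_PrimRec_Suc: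
    "computes (PrimRec f g) (n # xs) u \<Longrightarrow> computes g (n # u # xs) y \<Longrightarrow>
     computes (PrimRec f g) (Suc n # xs) y"
| computes_Mu:
    "computes f (y # xs) 0 \<Longrightarrow> (\<And>z. z < y \<Longrightarrow> computes f (z # xs) (Suc (v z))) \<Longrightarrow>
     computes (Mu f) xs y"

lemma computes_deterministic:
  "computes f xs y \<Longrightarrow> computes f xs y' \<Longrightarrow> y = y'"
proof (induction arbitrary: y' rule: computes.induct)
  case (computes_Comp ys gs xs f y)
  from computes_Comp.prems obtain ys' where
    ys': "length ys' = length gs" "\<And>i. i < length gs \<Longrightarrow> computes (gs ! i) xs (ys' ! i)"
      "computes f ys' y'"
    by (cases rule: computes.cases) auto
  have "ys = ys'"
    using computes_Comp.hyps(1) ys'(1,2) computes_Comp.IH(1) by (intro nth_equalityI) auto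
  with ys'(3) computes_Comp.IH(2) show ?case by blast
next
  case (computes_PrimRec_Suc f g n xs u y)
  from computes_PrimRec_Suc.prems obtain u' where
    "computes (PrimRec f g) (n # xs) u'" "computes g (n # u' # xs) y'"
    by (cases rule: computes.cases) auto
  with computes_PrimRec_Suc.IH show ?case by metis
next
  case (computes_Mu f y xs v)
  from computes_Mu.prems obtain v' where
    y': "computes f (y' # xs) 0" "\<And>z. z < y' \<Longrightarrow> computes f (z # xs) (Suc (v' z))"
    by (cases rule: computes.cases) auto
  have "\<not> y' < y" using computes_Mu.IH(2) y'(1) by fastforce
  moreover have "\<not> y < y'" using computes_Mu.IH(1) y'(2) by fastforce
  ultimately show ?case by simp
qed (erule computes.cases; auto)+

section \<open>Coding of formulas\<close>

fun code_srt :: "srt \<Rightarrow> nat" where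
  "code_srt CarSort = 0"
| "code_srt RealSort = 1"
| "code_srt LaneSort = 2"

fun code_sym :: "sym \<Rightarrow> nat" where
  "code_sym Ego = prod_encode (0, 0)"
| "code_sym (Var s x) = prod_encode (1, prod_encode (code_srt s, x))"

fun code_trm :: "nat trm \<Rightarrow> nat" where
  "code_trm (LaneConst n) = prod_encode (0, n)"
| "code_trm (RealConst k) = prod_encode (1, k)"
| "code_trm (Sym c) = prod_encode (2, code_sym c)"
| "code_trm Length = prod_encode (3, 0)"
| "code_trm Width = prod_encode (4, 0)"
| "code_trm (Plus a b) = prod_encode (5, prod_encode (code_trm a, code_trm b))"

fun code_fm :: "nat fm \<Rightarrow> nat" where
  "code_fm Bot = prod_encode (0, 0)"
| "code_fm (Eq a b) = prod_encode (1, prod_encode (code_trm a, code_trm b))"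
| "code_fm (Re c) = prod_encode (2, code_sym c)"
| "code_fm (Cl c) = prod_encode (3, code_sym c)"
| "code_fm (Imp \<phi> \<psi>) = prod_encode (4, prod_encode (code_fm \<phi>, code_fm \<psi>))"
| "code_fm (All s x \<phi>) = prod_encode (5, prod_encode (prod_encode (code_srt s, x), code_fm \<phi>))"
| "code_fm (HChop \<phi> \<psi>) = prod_encode (6, prod_encode (code_fm \<phi>, code_fm \<psi>))"
| "code_fm (VChop \<phi> \<psi>) = prod_encode (7, prod_encode (code_fm \<phi>, code_fm \<psi>))"

lemma code_srt_inject [simp]: "code_srt s = code_srt s' \<longleftrightarrow> s = s'"
  by (cases s; cases s') auto

lemma code_sym_inject [simp]: "code_sym c = code_sym c' \<longleftrightarrow> c = c'"
  by (cases c; cases c') auto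

lemma code_trm_inject [simp]: "code_trm a = code_trm b \<longleftrightarrow> a = b"
proof (induction a arbitrary: b)
  case (Plus a1 a2) then show ?case by (cases b) auto
qed (case_tac b; auto)+

lemma code_fm_inject [simp]: "code_fm \<phi> = code_fm \<psi> \<longleftrightarrow> \<phi> = \<psi>"
  by (induction \<phi> arbitrary: \<psi>; case_tac \<psi>; auto)

end

theory Submission
  imports Defs
begin

text \<open>
  On a single lane the cars of a snapshot form an arbitrary finite tape: the cell at position \<open>s\<close>
  contains \<open>v\<close> if some car occupies exactly the segment from \<open>s\<close> to \<open>s + v + 1\<close>, and this is
  expressible by horizontal chops and reservations. Real variables with addition and the tape
  suffice to say that a partial recursive function \<open>h\<close> maps \<open>xs\<close> to \<open>y\<close>: the intermediate values
  of primitive recursions are looked up on the tape. This is sound on every tape whose cells are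
  closed under predecessors, and whenever \<open>h\<close> does map \<open>xs\<close> to \<open>y\<close>, some finite tape witnesses
  it. Hence \<open>h(n) = 0\<close> is the satisfiability of a formula that depends computably on \<open>n\<close>, and
  a decision procedure is refuted by Goedel's diagonal construction: there is a formula that is
  satisfiable iff the procedure rejects that formula.
\<close>

section \<open>Computations on a tape\<close>

definition cell :: "(real \<Rightarrow> real \<Rightarrow> bool) \<Rightarrow> real \<Rightarrow> bool" where
  "cell G x \<longleftrightarrow> (\<exists>v. G x v)"

text \<open>
  The values of a primitive recursion occupy the consecutive cells \<open>s\<close>, \<open>s + 1\<close>, \<dots> of the
  tape, and every one of them has to be justified by its predecessor; \<open>i \<le> hd xs\<close> is expressed by
  the difference \<open>d\<close> being a cell. The variables range over the reals, and the tape need not be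
  functional.
\<close>

function represents :: "(real \<Rightarrow> real \<Rightarrow> bool) \<Rightarrow> recf \<Rightarrow> real list \<Rightarrow> real \<Rightarrow> bool" where
  "represents G Zero xs y \<longleftrightarrow> y = 0"
| "represents G Succ xs y \<longleftrightarrow> length xs = 1 \<and> y = hd xs + 1"
| "represents G (Proj i) xs y \<longleftrightarrow> i < length xs \<and> y = xs ! i"
| "represents G (Comp f gs) xs y \<longleftrightarrow>
     (\<exists>zs. length zs = length gs \<and>
        (\<forall>i\<in>{..<length gs}. represents G (gs ! i) xs (zs ! i)) \<and> represents G f zs y)"
| "represents G (PrimRec f g) xs y \<longleftrightarrow>
     xs \<noteq> [] \<and>
     (\<exists>s. cell G s \<and> G (s + hd xs) y \<and>
        (\<forall>i d u. cell G i \<and> cell G d \<and> i + d = hd xs \<and> G (s + i) u \<longrightarrow>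
           i = 0 \<and> represents G f (tl xs) u \<or>
           (\<exists>j w. cell G j \<and> i = j + 1 \<and> G (s + j) w \<and> represents G g (j # w # tl xs) u)))"
| "represents G (Mu f) xs y \<longleftrightarrow>
     cell G y \<and> represents G f (y # xs) 0 \<and>
     (\<forall>z d. cell G z \<and> cell G d \<and> z + d = y \<and> d \<noteq> 0 \<longrightarrow> (\<exists>v. v \<noteq> 0 \<and> represents G f (z # xs) v))"
  by pat_completeness auto
text \<open>The components of a composition are smaller because \<open>size\<close> of a list of
  functions bounds \<open>size\<close> of each entry.\<close>

termination
  by (relation "measure (\<lambda>(_, h, _). size h)")
    (auto simp: less_Suc_eq_le intro!: trans_le_add1 size_list_estimation'[OF nth_mem])

section \<open>Soundness of the representation\<close>

definition cells_initial :: "(real \<Rightarrow> real \<Rightarrow> bool) \<Rightarrow> bool" where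
  "cells_initial G \<longleftrightarrow> (\<forall>s. cell G s \<longrightarrow> s = 0 \<or> (\<exists>s'. cell G s' \<and> s = s' + 1))"

text \<open>Descending from \<open>x\<close> in steps of 1 stays among the cells and, as cells are
  nonnegative, must end at 0. Hence real variables guarded by \<open>cell\<close> range over natural
  numbers.\<close>

lemma cells_initialD:
  assumes "cells_initial G" and nonneg: "\<And>s. cell G s \<Longrightarrow> 0 \<le> s" and "cell G x"
  obtains n where "x = real n" and "\<And>m. m \<le> n \<Longrightarrow> cell G (real m)"
proof -
  have "\<exists>n. x = real n \<and> (\<forall>m\<le>n. cell G (real m))" if "cell G x" "x < real k" for k x
    using that
  proof (induction k arbitrary: x)
    case 0
    then show ?case using nonneg[of x] by simp
  next
    case (Suc k)
    show ?case
    proof (cases "x = 0")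
      case True
      then show ?thesis using Suc.prems by (intro exI[of _ 0]) auto
    next
      case False
      then obtain s where s: "cell G s" "x = s + 1"
        using assms(1) Suc.prems by (auto simp: cells_initial_def)
      with Suc.prems have "s < real k" by simp
      then obtain n where "s = real n" "\<forall>m\<le>n. cell G (real m)"
        using Suc.IH s by blast
      with s Suc.prems show ?thesis
        by (intro exI[of _ "Suc n"]) (auto simp: le_Suc_eq add.commute)
    qed
  qed
  moreover obtain k where "x < real k" using reals_Archimedean2 by blast
  ultimately show thesis using assms(3) that by blast
qed

text \<open>Structural induction on \<open>h\<close>. A cell may hold several values, but the
  universal clause for primitive recursion justifies every value found between \<open>s\<close> and
  \<open>s + n\<close>, so all of them are correct.\<close>

lemma represents_imp_computes:
  assumes "cells_initial G" and nonneg: "\<And>s. cell G s \<Longrightarrow> 0 \<le> s"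
    and "represents G h (map real ns) y"
  shows "\<exists>m. y = real m \<and> computes h ns m"
  using assms(3)
proof (induction h arbitrary: ns y)
  case Zero
  then show ?case by (auto intro: computes_Zero)
next
  case Succ
  then obtain n where "ns = [n]" by (auto simp: length_Suc_conv)
  with Succ show ?case by (auto intro!: exI[of _ "Suc n"] computes_Succ)
next
  case (Proj i)
  then show ?case by (auto intro!: exI[of _ "ns ! i"] computes_Proj)
next
  case (Comp f gs)
  from Comp.prems obtain zs where zs: "length zs = length gs"
    "\<And>i. i < length gs \<Longrightarrow> represents G (gs ! i) (map real ns) (zs ! i)" "represents G f zs y"
    by auto
  have "\<exists>m. zs ! i = real m \<and> computes (gs ! i) ns m" if "i < length gs" for i
    using Comp.IH(2)[of "gs ! i" ns "zs ! i"] zs(2) that by simp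
  then obtain m where m: "\<And>i. i < length gs \<Longrightarrow> zs ! i = real (m i) \<and> computes (gs ! i) ns (m i)"
    by metis
  let ?ms = "map m [0..<length gs]"
  have "zs = map real ?ms"
    using zs(1) m by (intro nth_equalityI) auto
  then obtain k where "y = real k" "computes f ?ms k"
    using Comp.IH(1)[of ?ms y] zs(3) by auto
  moreover have "computes (Comp f gs) ns k"
    by (rule computes_Comp[of ?ms]) (use m calculation in auto)
  ultimately show ?case by blast
next
  case (PrimRec f g)
  then obtain n ms where ns: "ns = n # ms" by (cases ns) auto
  from PrimRec.prems ns obtain s where s: "cell G s" "G (s + real n) y" and step:
    "\<And>i d u. cell G i \<Longrightarrow> cell G d \<Longrightarrow> i + d = real n \<Longrightarrow> G (s + i) u \<Longrightarrow>
       i = 0 \<and> represents G f (map real ms) u \<or>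
       (\<exists>j w. cell G j \<and> i = j + 1 \<and> G (s + j) w \<and> represents G g (j # w # map real ms) u)"
    by auto
  \<comment> \<open>\<open>s\<close> and \<open>s + n\<close> are cells, hence natural numbers, so
    all numbers up to \<open>n\<close> are cells; this satisfies the guards on \<open>i\<close> and
    \<open>d\<close> in \<open>step\<close> for every \<open>i \<le> n\<close>.\<close>
  obtain k where k: "s = real k" using cells_initialD[OF assms(1) nonneg s(1)] by auto
  have "cell G (s + real n)" using s(2) by (auto simp: cell_def)
  then obtain k' where k': "s + real n = real k'" "\<And>m. m \<le> k' \<Longrightarrow> cell G (real m)"
    using cells_initialD[OF assms(1) nonneg] by metis
  have cells: "cell G (real m)" if "m \<le> n" for m using k k' that by simp
  have "\<exists>m. u = real m \<and> computes (PrimRec f g) (i # ms) m"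
    if "i \<le> n" "G (s + real i) u" for i u
    using that
  proof (induction i arbitrary: u)
    case 0
    \<comment> \<open>A predecessor of 0 would be the negative cell -1, so only the base case of
      \<open>step\<close> remains.\<close>
    have "\<not> (\<exists>j. cell G j \<and> 0 = j + 1)" using nonneg by force
    then have "represents G f (map real ms) u"
      using step[of 0 "real n" u] cells[of 0] cells[of n] 0 by auto
    then show ?case using PrimRec.IH(1) by (blast intro: computes_PrimRec_0)
  next
    case (Suc i)
    obtain j w where j: "cell G j" "real (Suc i) = j + 1" "G (s + j) w"
      "represents G g (j # w # map real ms) u"
      using step[of "real (Suc i)" "real (n - Suc i)" u] cells[of "Suc i"] cells[of "n - Suc i"] Suc
      by (auto simp: of_nat_diff)
    have ji: "j = real i" using j(2) by simp
    then obtain m where m: "w = real m" "computes (PrimRec f g) (i # ms) m"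
      using Suc.IH[of w] Suc.prems j(3) by auto
    have "represents G g (map real (i # m # ms)) u" using j(4) ji m by simp
    then obtain v where "u = real v" "computes g (i # m # ms) v" using PrimRec.IH(2) by blast
    with m show ?case by (blast intro: computes_PrimRec_Suc)
  qed
  then show ?case using s(2) ns by blast
next
  case (Mu f)
  obtain n where n: "y = real n" "\<And>m. m \<le> n \<Longrightarrow> cell G (real m)"
    using cells_initialD[OF assms(1) nonneg] Mu.prems by (metis represents.simps(6))
  have "represents G f (map real (n # ns)) 0" using Mu.prems n(1) by simp
  then have "computes f (n # ns) 0" using Mu.IH by fastforce
  moreover have "\<exists>v. computes f (z # ns) (Suc v)" if "z < n" for z
  proof -
    \<comment> \<open>The difference \<open>n - z\<close> is itself a cell and serves as the
      certificate \<open>d\<close> for \<open>z < n\<close>.\<close>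
    have "cell G (real z)" "cell G (real (n - z))" "real z + real (n - z) = y" "real (n - z) \<noteq> 0"
      using that n(1) n(2)[of z] n(2)[of "n - z"] by auto
    then obtain v where "v \<noteq> 0" "represents G f (real z # map real ns) v"
      using Mu.prems unfolding represents.simps by blast
    then obtain m where "v = real m" "computes f (z # ns) m" using Mu.IH[of "z # ns" v] by auto
    with \<open>v \<noteq> 0\<close> show ?thesis by (cases m) auto
  qed
  then obtain v where "\<And>z. z < n \<Longrightarrow> computes f (z # ns) (Suc (v z))" by metis
  ultimately show ?case using n(1) by (auto intro: computes_Mu)
qed

section \<open>Completeness of the representation\<close>

definition list_tape :: "nat list \<Rightarrow> real \<Rightarrow> real \<Rightarrow> bool" where
  "list_tape w s v \<longleftrightarrow> (\<exists>i<length w. s = real i \<and> v = real (w ! i))"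

lemma cell_list_tape: "cell (list_tape w) x \<longleftrightarrow> (\<exists>i<length w. x = real i)"
  by (auto simp: cell_def list_tape_def)

lemma cells_initial_list_tape: "cells_initial (list_tape w)"
  unfolding cells_initial_def cell_list_tape
proof (intro allI impI)
  fix s assume "\<exists>i<length w. s = real i"
  then obtain i where "i < length w" "s = real i" by blast
  then show "s = 0 \<or> (\<exists>s'. (\<exists>i<length w. s' = real i) \<and> s = s' + 1)"
    by (cases i) (auto intro!: exI[of _ "real (i - 1)"] exI[of _ "i - 1"])
qed

lemma concat_map_upt_split:
  assumes "i < n"
  obtains a b where "concat (map W [0..<n]) = a @ W i @ b"
proof -
  have "[0..<n] = [0..<i] @ i # [Suc i..<n]"
    using assms upt_add_eq_append[of 0 i "n - i"] by (simp add: upt_conv_Cons)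
  then show thesis using that by simp
qed

text \<open>The surrounding words \<open>pre\<close> and \<open>post\<close> make it possible to concatenate the tapes of the
  subcomputations.\<close>

lemma computes_imp_represents:
  assumes "computes h ns y"
  shows "\<exists>w. \<forall>pre post. represents (list_tape (pre @ w @ post)) h (map real ns) (real y)"
  using assms
proof (induction h arbitrary: ns y)
  case Zero
  then show ?case by (auto elim: computes.cases)
next
  case Succ
  then show ?case by (auto elim: computes.cases)
next
  case (Proj i)
  then show ?case by (auto elim: computes.cases)
next
  case (Comp f gs)
  from Comp.prems obtain ys where ys: "length ys = length gs"
    "\<And>i. i < length gs \<Longrightarrow> computes (gs ! i) ns (ys ! i)" "computes f ys y"
    by (cases rule: computes.cases) auto
  have "\<exists>w. \<forall>pre post. represents (list_tape (pre @ w @ post)) (gs ! i) (map real ns) (real (ys ! i))"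
    if "i < length gs" for i
    using Comp.IH(2)[of "gs ! i"] ys(2) that by simp
  then obtain W where W: "\<And>i pre post. i < length gs \<Longrightarrow>
      represents (list_tape (pre @ W i @ post)) (gs ! i) (map real ns) (real (ys ! i))"
    by metis
  obtain w where w: "\<And>pre post. represents (list_tape (pre @ w @ post)) f (map real ys) (real y)"
    using Comp.IH(1) ys(3) by blast
  have "represents (list_tape (pre @ (concat (map W [0..<length gs]) @ w) @ post))
      (Comp f gs) (map real ns) (real y)" for pre post
    unfolding represents.simps
  proof (intro exI[of _ "map real ys"] conjI ballI)
    fix i assume i: "i \<in> {..<length gs}"
    then obtain a b where "concat (map W [0..<length gs]) = a @ W i @ b"
      using concat_map_upt_split by blast
    then show "represents (list_tape (pre @ (concat (map W [0..<length gs]) @ w) @ post))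
        (gs ! i) (map real ns) (map real ys ! i)"
      using W[of i "pre @ a" "b @ w @ post"] i ys(1) by simp
  qed (use ys(1) w[of "pre @ concat (map W [0..<length gs])" post] in auto)
  then show ?case by blast
next
  case (PrimRec f g)
  obtain n ms where ns: "ns = n # ms"
    using PrimRec.prems by (cases rule: computes.cases) auto
  \<comment> \<open>\<open>u i\<close> is the value of the recursion at \<open>i\<close>; the whole
    history is needed because it is written on the tape.\<close>
  have "\<exists>u. computes f ms (u 0) \<and> (\<forall>i<n. computes g (i # u i # ms) (u (Suc i))) \<and> u n = y"
    using PrimRec.prems unfolding ns
  proof (induction n arbitrary: y)
    case 0
    then have "computes f ms y" by (cases rule: computes.cases) auto
    then show ?case by (intro exI[of _ "\<lambda>_. y"]) simp
  next
    case (Suc n)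
    from Suc.prems obtain v where v: "computes (PrimRec f g) (n # ms) v" "computes g (n # v # ms) y"
      by (cases rule: computes.cases) auto
    then obtain u where "computes f ms (u 0)" "\<forall>i<n. computes g (i # u i # ms) (u (Suc i))" "u n = v"
      using Suc.IH by blast
    then show ?case using v(2) by (intro exI[of _ "u(Suc n := y)"]) (auto simp: less_Suc_eq)
  qed
  then obtain u where u: "computes f ms (u 0)" "\<And>i. i < n \<Longrightarrow> computes g (i # u i # ms) (u (Suc i))"
    "u n = y" by blast
  obtain w where w: "\<And>pre post. represents (list_tape (pre @ w @ post)) f (map real ms) (real (u 0))"
    using PrimRec.IH(1) u(1) by blast
  have "\<exists>w. \<forall>pre post. represents (list_tape (pre @ w @ post)) g
      (map real (i # u i # ms)) (real (u (Suc i)))" if "i < n" for i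
    using PrimRec.IH(2) u(2) that by blast
  then obtain W where W: "\<And>i pre post. i < n \<Longrightarrow> represents (list_tape (pre @ W i @ post)) g
      (map real (i # u i # ms)) (real (u (Suc i)))"
    by metis
  \<comment> \<open>The values \<open>u 0\<close> to \<open>u n\<close> come first, so that with
    \<open>s\<close> the length of \<open>pre\<close> the value for \<open>i\<close> stands in cell
    \<open>s + i\<close>; the tapes justifying the base case and the single steps follow.\<close>
  let ?us = "map u [0..<Suc n]" and ?W = "concat (map W [0..<n])"
  have "represents (list_tape (pre @ (?us @ w @ ?W) @ post))
      (PrimRec f g) (map real ns) (real y)" for pre post
  proof -
    define t where "t = pre @ (?us @ w @ ?W) @ post"
    have len: "length pre + n < length t" by (simp add: t_def)
    have nth: "t ! (length pre + i) = u i" if "i \<le> n" for i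
      using that by (simp add: t_def nth_append less_Suc_eq_le del: upt_Suc)
    have tape: "list_tape t (real (length pre) + real i) v \<longleftrightarrow> v = real (u i)" if "i \<le> n" for i v
      using that len nth unfolding list_tape_def
      by (metis add_left_mono le_less_trans of_nat_add of_nat_eq_iff)
    have cell: "cell (list_tape t) (real i)" if "i \<le> n" for i
      using that len by (auto simp: cell_list_tape)
    show ?thesis
      unfolding represents.simps t_def[symmetric] ns
    proof (intro conjI exI[of _ "real (length pre)"] allI impI)
      show "cell (list_tape t) (real (length pre))" using len by (auto simp: cell_list_tape)
      show "list_tape t (real (length pre) + hd (map real (n # ms))) (real y)"
        using tape[of n] u(3) by simp
      fix i d v
      assume *: "cell (list_tape t) i \<and> cell (list_tape t) d \<and> i + d = hd (map real (n # ms)) \<and>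
        list_tape t (real (length pre) + i) v"
      \<comment> \<open>Natural summands of \<open>n\<close> are at most \<open>n\<close>, so cell
        \<open>s + i\<close> lies in the block of values and holds only \<open>u k\<close>.\<close>
      then obtain k l where kl: "i = real k" "d = real l" "real k + real l = real n"
        by (auto simp: cell_list_tape)
      then have kn: "k \<le> n" by linarith
      then have v: "v = real (u k)" using * kl tape by blast
      show "i = 0 \<and> represents (list_tape t) f (tl (map real (n # ms))) v \<or>
        (\<exists>j w. cell (list_tape t) j \<and> i = j + 1 \<and> list_tape t (real (length pre) + j) w \<and>
           represents (list_tape t) g (j # w # tl (map real (n # ms))) v)"
      proof (cases k)
        case 0
        then show ?thesis using w[of "pre @ ?us" "?W @ post"] kl v by (simp add: t_def)
      next
        case (Suc j)
        then have j: "j < n" using kn by simp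
        then obtain a b where "?W = a @ W j @ b" using concat_map_upt_split by blast
        then have "represents (list_tape t) g (real j # real (u j) # map real ms) v"
          using W[OF j, of "pre @ ?us @ w @ a" "b @ post"] v Suc by (simp add: t_def)
        then show ?thesis
          using Suc kl(1) j cell[of j] tape[of j]
          by (intro disjI2 exI[of _ "real j"] exI[of _ "real (u j)"]) auto
      qed
    qed simp
  qed
  then show ?case by blast
next
  case (Mu f)
  from Mu.prems obtain v where v: "computes f (y # ns) 0"
    "\<And>z. z < y \<Longrightarrow> computes f (z # ns) (Suc (v z))"
    by (cases rule: computes.cases) auto
  obtain w where w: "\<And>pre post. represents (list_tape (pre @ w @ post)) f (map real (y # ns)) (real 0)"
    using Mu.IH v(1) by blast
  have "\<exists>w. \<forall>pre post. represents (list_tape (pre @ w @ post)) f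
      (map real (z # ns)) (real (Suc (v z)))" if "z < y" for z
    using Mu.IH v(2) that by blast
  then obtain W where W: "\<And>z pre post. z < y \<Longrightarrow> represents (list_tape (pre @ W z @ post)) f
      (map real (z # ns)) (real (Suc (v z)))"
    by metis
  let ?W = "concat (map W [0..<y])"
  \<comment> \<open>The \<open>y + 1\<close> zeros are padding that makes the tape long enough for
    \<open>y\<close> to be a cell.\<close>
  have "represents (list_tape (pre @ (replicate (Suc y) 0 @ w @ ?W) @ post))
      (Mu f) (map real ns) (real y)" for pre post
    unfolding represents.simps
  proof (intro conjI allI impI)
    let ?t = "pre @ (replicate (Suc y) 0 @ w @ ?W) @ post"
    show "cell (list_tape ?t) (real y)" by (auto simp: cell_list_tape)
    show "represents (list_tape ?t) f (real y # map real ns) 0"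
      using w[of "pre @ replicate (Suc y) 0" "?W @ post"] by simp
    fix z d
    assume "cell (list_tape ?t) z \<and> cell (list_tape ?t) d \<and> z + d = real y \<and> d \<noteq> 0"
    then obtain k l where k: "z = real k" "d = real l" "real k + real l = real y" "l \<noteq> 0"
      by (auto simp: cell_list_tape)
    then have "k < y" by linarith
    moreover from this obtain a b where "?W = a @ W k @ b" using concat_map_upt_split by blast
    ultimately have "represents (list_tape ?t) f (z # map real ns) (real (Suc (v k)))"
      using W[of k "pre @ replicate (Suc y) 0 @ w @ a" "b @ post"] k(1) by simp
    then show "\<exists>v. v \<noteq> 0 \<and> represents (list_tape ?t) f (z # map real ns) v"
      by (intro exI[of _ "real (Suc (v k))"]) simp
  qed
  then show ?case by blast
qed

section \<open>Tapes of cars and definability\<close>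

text \<open>The truth condition of \<open>Re\<close> with explicit end points: only the lanes and
  the owner of \<open>V\<close> enter, so horizontal chops of \<open>V\<close> do not affect
  it.\<close>

definition covers :: "'i sensors \<Rightarrow> 'i snapshot \<Rightarrow> 'i view \<Rightarrow> 'i \<Rightarrow> real \<Rightarrow> real \<Rightarrow> bool" where
  "covers \<Omega> T V C a b \<longleftrightarrow>
     card (lanes V) = 1 \<and> a < b \<and> res T C \<inter> lanes V = lanes V \<and>
     {a..b} = {pos T C..pos T C + \<Omega> (owner V) C T} \<inter> {a..b}"

text \<open>A car that starts at distance \<open>s\<close> from the left end of the view stores the value \<open>v\<close>
  by having length \<open>v + 1\<close>, as lengths are positive.\<close>

definition car_tape :: "'i sensors \<Rightarrow> 'i snapshot \<Rightarrow> 'i view \<Rightarrow> real \<Rightarrow> real \<Rightarrow> bool" where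
  "car_tape \<Omega> T V s v \<longleftrightarrow>
     (\<exists>C p q. left V \<le> p \<and> p \<le> q \<and> q \<le> right V \<and> p - left V = s \<and> q - p = v + 1 \<and>
        covers \<Omega> T V C p q \<and>
        (\<forall>r. left V \<le> r \<and> r \<le> p \<longrightarrow> \<not> covers \<Omega> T V C r p) \<and>
        (\<forall>r. q \<le> r \<and> r \<le> right V \<longrightarrow> \<not> covers \<Omega> T V C q r))"

lemma cell_car_tape_nonneg: "cell (car_tape \<Omega> T V) s \<Longrightarrow> 0 \<le> s"
  by (auto simp: cell_def car_tape_def)

section \<open>Formulas about the tape\<close>

abbreviation Neg :: "'k fm \<Rightarrow> 'k fm" where
  "Neg \<phi> \<equiv> Imp \<phi> Bot"

abbreviation Conj :: "'k fm \<Rightarrow> 'k fm \<Rightarrow> 'k fm" where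
  "Conj \<phi> \<psi> \<equiv> Neg (Imp \<phi> (Neg \<psi>))"

text \<open>\<open>Re\<close> holds on every nondegenerate part of a car's segment. The two negated
  chops forbid the car to cover an adjacent piece on either side within the view, which pins down
  its end points.\<close>

definition car_fm :: "'k trm \<Rightarrow> 'k trm \<Rightarrow> 'k fm" where
  "car_fm \<sigma> \<tau> =
     Neg (All CarSort 0 (Neg
       (HChop (Conj (Eq Length \<sigma>) (Neg (HChop (Neg Bot) (Re (Var CarSort 0)))))
          (HChop (Conj (Re (Var CarSort 0)) (Eq Length \<tau>))
             (Neg (HChop (Re (Var CarSort 0)) (Neg Bot)))))))"

lemma models_Re:
  "\<nu> c = CarVal C \<Longrightarrow> models N \<Omega> T V \<nu> (Re c) \<longleftrightarrow> covers \<Omega> T V C (left V) (right V)"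
  by (auto simp: covers_def res_in_def len_in_def extension_def)

lemma covers_chop [simp]:
  "covers \<Omega> T (V\<lparr>left := p\<rparr>) = covers \<Omega> T V" "covers \<Omega> T (V\<lparr>right := p\<rparr>) = covers \<Omega> T V"
  by (auto simp: covers_def fun_eq_iff)

lemma models_HChop:
  "models N \<Omega> T V \<nu> (HChop \<phi> \<psi>) \<longleftrightarrow>
     (\<exists>p. left V \<le> p \<and> p \<le> right V \<and>
        models N \<Omega> T (V\<lparr>right := p\<rparr>) \<nu> \<phi> \<and> models N \<Omega> T (V\<lparr>left := p\<rparr>) \<nu> \<psi>)"
  unfolding models.simps horizontal_chop_def by (metis atLeastAtMost_iff)

text \<open>The chops evaluate both terms in smaller views and under a new value of the car
  variable; the assumptions make their values insensitive to both.\<close>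

lemma models_car_fm:
  assumes "\<And>V C. trm_val V (\<nu>(Var CarSort 0 := CarVal C)) \<sigma> = NumVal s"
    and "\<And>V C. trm_val V (\<nu>(Var CarSort 0 := CarVal C)) \<tau> = NumVal (v + 1)"
  shows "models N \<Omega> T V \<nu> (car_fm \<sigma> \<tau>) \<longleftrightarrow> car_tape \<Omega> T V s v"
  unfolding car_fm_def car_tape_def
  by (simp add: models_HChop models_Re assms del: models.simps(3,7)) (auto; blast)

text \<open>Lane constants above \<open>N\<close> are ill-formed and the notation \<rho> may name no
  natural number at all, so numbers are built as sums of lane constants 0 and 1. They can be equated
  with real variables since both sorts share \<open>NumVal\<close>.\<close>

fun numeral_trm :: "nat \<Rightarrow> 'k trm" where
  "numeral_trm 0 = LaneConst 0"
| "numeral_trm (Suc n) = Plus (numeral_trm n) (LaneConst 1)"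

lemma sort_of_numeral_trm [simp]: "sort_of (numeral_trm n) = LaneSort"
  by (induction n) auto

lemma wf_numeral_trm: "1 \<le> N \<Longrightarrow> wf_trm N (numeral_trm n)"
  by (induction n) auto

lemma trm_val_numeral_trm [simp]:
  "trm_val V \<nu> (map_trm \<rho> (numeral_trm n)) = NumVal (real n)"
  by (induction n) (auto simp: add.commute)

definition reals_of :: "'i valuation \<Rightarrow> nat \<Rightarrow> real" where
  "reals_of \<nu> x = num_of (\<nu> (Var RealSort x))"

lemma reals_of_upd_real [simp]: "reals_of (\<nu>(Var RealSort x := NumVal a)) = (reals_of \<nu>)(x := a)"
  by (auto simp: reals_of_def)

lemma reals_of_upd_car [simp]: "reals_of (\<nu>(Var CarSort x := a)) = reals_of \<nu>"
  by (auto simp: reals_of_def)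

lemma sort_respecting_upd:
  "sort_respecting N \<nu> \<Longrightarrow> a \<in> sort_values N s \<Longrightarrow> sort_respecting N (\<nu>(Var s x := a))"
  by (auto simp: sort_respecting_def)

lemma sort_respecting_real:
  "sort_respecting N \<nu> \<Longrightarrow> \<nu> (Var RealSort x) = NumVal (reals_of \<nu> x)"
  unfolding sort_respecting_def reals_of_def
  by (drule spec[of _ "Var RealSort x"]) auto

definition assign :: "nat \<Rightarrow> real list \<Rightarrow> (nat \<Rightarrow> real) \<Rightarrow> nat \<Rightarrow> real" where
  "assign b zs e x = (if b \<le> x \<and> x < b + length zs then zs ! (x - b) else e x)"

lemma assign_Nil [simp]: "assign b [] e = e"
  by (auto simp: assign_def fun_eq_iff)

lemma assign_snoc: "assign b (zs @ [a]) e = (assign b zs e)(b + length zs := a)"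
  by (auto simp: assign_def fun_eq_iff nth_append)

section \<open>Predicates definable by formulas\<close>

locale real_notation =
  fixes car_type :: "'i itself" and N :: nat and \<rho> :: "nat \<Rightarrow> real"
  assumes two_lanes: "1 \<le> N"
begin

text \<open>The formula sees the model only through its car tape and real variables, so definability
  can be derived for predicates without writing formulas out.\<close>

definition expresses :: "nat fm \<Rightarrow> ((real \<Rightarrow> real \<Rightarrow> bool) \<Rightarrow> (nat \<Rightarrow> real) \<Rightarrow> bool) \<Rightarrow> bool" where
  "expresses \<phi> P \<longleftrightarrow>
     wf_fm N \<phi> \<and>
     (\<forall>\<Omega> T (V :: 'i view) \<nu>. sort_respecting N \<nu> \<longrightarrow>
        models N \<Omega> T V \<nu> (map_fm \<rho> \<phi>) \<longleftrightarrow> P (car_tape \<Omega> T V) (reals_of \<nu>))"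

definition definable :: "((real \<Rightarrow> real \<Rightarrow> bool) \<Rightarrow> (nat \<Rightarrow> real) \<Rightarrow> bool) \<Rightarrow> bool" where
  "definable P \<longleftrightarrow> (\<exists>\<phi>. expresses \<phi> P)"

text \<open>The value must not depend on the view, so that it survives chops; the bound
  \<open>b\<close> supplies fresh variables for quantifiers.\<close>

definition definable_trm :: "((nat \<Rightarrow> real) \<Rightarrow> real) \<Rightarrow> bool" where
  "definable_trm t \<longleftrightarrow>
     (\<exists>\<tau>. wf_trm N \<tau> \<and> sort_of \<tau> = RealSort \<and>
        (\<forall>(V :: 'i view) \<nu>. sort_respecting N \<nu> \<longrightarrow>
           trm_val V \<nu> (map_trm \<rho> \<tau>) = NumVal (t (reals_of \<nu>)))) \<and>
     (\<exists>b. \<forall>x\<ge>b. \<forall>e a. t (e(x := a)) = t e)"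

lemma definable_trm_var: "definable_trm (\<lambda>e. e x)"
  unfolding definable_trm_def
  by (intro conjI exI[of _ "Sym (Var RealSort x)"] exI[of _ "Suc x"]) (auto simp: sort_respecting_real)

lemma definable_trm_add:
  assumes "definable_trm t" "definable_trm u"
  shows "definable_trm (\<lambda>e. t e + u e)"
proof -
  from assms obtain \<tau> \<upsilon> b c where *: "wf_trm N \<tau>" "sort_of \<tau> = RealSort"
    "\<forall>(V :: 'i view) \<nu>. sort_respecting N \<nu> \<longrightarrow> trm_val V \<nu> (map_trm \<rho> \<tau>) = NumVal (t (reals_of \<nu>))"
    "\<forall>x\<ge>b. \<forall>e a. t (e(x := a)) = t e"
    "wf_trm N \<upsilon>" "sort_of \<upsilon> = RealSort"
    "\<forall>(V :: 'i view) \<nu>. sort_respecting N \<nu> \<longrightarrow> trm_val V \<nu> (map_trm \<rho> \<upsilon>) = NumVal (u (reals_of \<nu>))"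
    "\<forall>x\<ge>c. \<forall>e a. u (e(x := a)) = u e"
    unfolding definable_trm_def by blast
  show ?thesis
    unfolding definable_trm_def
    by (intro conjI exI[of _ "Plus \<tau> \<upsilon>"] exI[of _ "max b c"]) (use * in auto)
qed

lemma definable_not:
  assumes "definable P"
  shows "definable (\<lambda>G e. \<not> P G e)"
proof -
  from assms obtain \<phi> where "expresses \<phi> P" by (auto simp: definable_def)
  then have "expresses (Neg \<phi>) (\<lambda>G e. \<not> P G e)" by (auto simp: expresses_def)
  then show ?thesis by (auto simp: definable_def)
qed

lemma definable_imp:
  assumes "definable P" "definable Q"
  shows "definable (\<lambda>G e. P G e \<longrightarrow> Q G e)"
proof -
  from assms obtain \<phi> \<psi> where "expresses \<phi> P" "expresses \<psi> Q" by (auto simp: definable_def)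
  then have "expresses (Imp \<phi> \<psi>) (\<lambda>G e. P G e \<longrightarrow> Q G e)" by (auto simp: expresses_def)
  then show ?thesis by (auto simp: definable_def)
qed

lemma definable_disj:
  assumes "definable P" "definable Q"
  shows "definable (\<lambda>G e. P G e \<or> Q G e)"
  using definable_imp[OF definable_not[OF assms(1)] assms(2)] by (simp add: disj_imp)

lemma definable_conj:
  assumes "definable P" "definable Q"
  shows "definable (\<lambda>G e. P G e \<and> Q G e)"
  using definable_not[OF definable_disj[OF definable_not[OF assms(1)] definable_not[OF assms(2)]]]
  by simp

text \<open>The variable \<open>x\<close> stands in for the bound \<open>a\<close>; the second
  assumption is its freshness for the rest of \<open>P\<close>.\<close>

lemma definable_all:
  assumes "definable (\<lambda>G e. P G e (e x))" and "\<And>G e a. P G (e(x := a)) a \<longleftrightarrow> P G e a"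
  shows "definable (\<lambda>G e. \<forall>a. P G e a)"
proof -
  from assms obtain \<phi> where "expresses \<phi> (\<lambda>G e. P G e (e x))" by (auto simp: definable_def)
  then have "expresses (All RealSort x \<phi>) (\<lambda>G e. \<forall>a. P G e a)"
    by (auto simp: expresses_def sort_respecting_upd assms(2))
  then show ?thesis by (auto simp: definable_def)
qed

lemma definable_ex:
  assumes "definable (\<lambda>G e. P G e (e x))" and "\<And>G e a. P G (e(x := a)) a \<longleftrightarrow> P G e a"
  shows "definable (\<lambda>G e. \<exists>a. P G e a)"
proof -
  have "definable (\<lambda>G e. \<forall>a. \<not> P G e a)"
    by (rule definable_all[where x = x]) (use assms definable_not in auto)
  then show ?thesis using definable_not by fastforce
qed

lemma definable_eq:
  assumes "definable_trm t" "definable_trm u"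
  shows "definable (\<lambda>G e. t e = u e)"
proof -
  from assms obtain \<tau> \<upsilon> where *: "wf_trm N \<tau>"
    "\<forall>(V :: 'i view) \<nu>. sort_respecting N \<nu> \<longrightarrow> trm_val V \<nu> (map_trm \<rho> \<tau>) = NumVal (t (reals_of \<nu>))"
    "wf_trm N \<upsilon>"
    "\<forall>(V :: 'i view) \<nu>. sort_respecting N \<nu> \<longrightarrow> trm_val V \<nu> (map_trm \<rho> \<upsilon>) = NumVal (u (reals_of \<nu>))"
    unfolding definable_trm_def by blast
  then have "expresses (Eq \<tau> \<upsilon>) (\<lambda>G e. t e = u e)" by (auto simp: expresses_def)
  then show ?thesis by (auto simp: definable_def)
qed

lemma definable_eq_numeral:
  assumes "definable_trm t"
  shows "definable (\<lambda>G e. t e = real n)"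
proof -
  from assms obtain \<tau> where *: "wf_trm N \<tau>"
    "\<forall>(V :: 'i view) \<nu>. sort_respecting N \<nu> \<longrightarrow> trm_val V \<nu> (map_trm \<rho> \<tau>) = NumVal (t (reals_of \<nu>))"
    unfolding definable_trm_def by blast
  then have "expresses (Eq \<tau> (numeral_trm n)) (\<lambda>G e. t e = real n)"
    by (auto simp: expresses_def wf_numeral_trm[OF two_lanes])
  then show ?thesis by (auto simp: definable_def)
qed

lemmas definable_eq_0 = definable_eq_numeral[of _ 0, simplified]
lemmas definable_eq_1 = definable_eq_numeral[of _ 1, simplified]

text \<open>\<open>Plus\<close> joins terms of one sort only, while the numeral 1 has lane sort; an
  equation across sorts transfers it to a fresh real variable.\<close>

lemma definable_eq_add_1:
  assumes "definable_trm t" "definable_trm u"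
  shows "definable (\<lambda>G e. t e = u e + 1)"
proof -
  from assms obtain b c where fresh:
    "\<forall>x\<ge>b. \<forall>e a. t (e(x := a)) = t e" "\<forall>x\<ge>c. \<forall>e a. u (e(x := a)) = u e"
    unfolding definable_trm_def by blast
  have "definable (\<lambda>G e. \<exists>k. k = 1 \<and> t e = u e + k)"
    by (rule definable_ex[where x = "max b c"])
      (use fresh assms in \<open>auto intro!: definable_conj definable_eq definable_eq_1
         definable_trm_var definable_trm_add\<close>)
  then show ?thesis by simp
qed

lemma definable_tape:
  assumes "definable_trm t" "definable_trm u"
  shows "definable (\<lambda>G e. G (t e) (u e))"
proof -
  from assms obtain \<tau> b c where *: "wf_trm N \<tau>"
    "\<forall>(V :: 'i view) \<nu>. sort_respecting N \<nu> \<longrightarrow> trm_val V \<nu> (map_trm \<rho> \<tau>) = NumVal (t (reals_of \<nu>))"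
    and fresh: "\<forall>x\<ge>b. \<forall>e a. t (e(x := a)) = t e" "\<forall>x\<ge>c. \<forall>e a. u (e(x := a)) = u e"
    unfolding definable_trm_def by blast
  let ?x = "max b c"
  have "expresses (car_fm \<tau> (Sym (Var RealSort x))) (\<lambda>G e. G (t e) (e x - 1))" for x
    unfolding expresses_def
  proof (intro conjI allI impI)
    show "wf_fm N (car_fm \<tau> (Sym (Var RealSort x)))"
      using * by (simp add: car_fm_def)
    fix \<Omega> T and \<nu> :: "'i valuation" and V :: "'i view"
    assume \<nu>: "sort_respecting N \<nu>"
    have "map_fm \<rho> (car_fm \<tau> (Sym (Var RealSort x))) = car_fm (map_trm \<rho> \<tau>) (Sym (Var RealSort x))"
      by (simp add: car_fm_def)
    moreover have "models N \<Omega> T V \<nu> (car_fm (map_trm \<rho> \<tau>) (Sym (Var RealSort x)))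
        \<longleftrightarrow> car_tape \<Omega> T V (t (reals_of \<nu>)) (reals_of \<nu> x - 1)"
      by (rule models_car_fm) (use \<nu> * in \<open>auto simp: sort_respecting_upd sort_respecting_real\<close>)
    ultimately show "models N \<Omega> T V \<nu> (map_fm \<rho> (car_fm \<tau> (Sym (Var RealSort x))))
        \<longleftrightarrow> car_tape \<Omega> T V (t (reals_of \<nu>)) (reals_of \<nu> x - 1)" by simp
  qed
  then have "definable (\<lambda>G e. G (t e) (e x - 1))" for x by (auto simp: definable_def)
  \<comment> \<open>\<open>car_fm\<close> measures the length of the car, which is the stored value
    plus one; \<open>k\<close> supplies this shifted value.\<close>
  then have "definable (\<lambda>G e. \<exists>k. k = u e + 1 \<and> G (t e) (k - 1))"
    by (intro definable_ex[where x = ?x])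
      (use fresh assms in \<open>auto intro!: definable_conj definable_eq_add_1 definable_trm_var\<close>)
  then show ?thesis by simp
qed

lemma definable_cell:
  assumes "definable_trm t"
  shows "definable (\<lambda>G e. cell G (t e))"
proof -
  from assms obtain b where fresh: "\<forall>x\<ge>b. \<forall>e a. t (e(x := a)) = t e"
    unfolding definable_trm_def by blast
  show ?thesis
    unfolding cell_def
    by (rule definable_ex[where x = b])
      (use fresh assms in \<open>auto intro!: definable_tape definable_trm_var\<close>)
qed

text \<open>Restricted to a sum on the left, so that equations like \<open>i = j + 1\<close> are
  left to \<open>definable_eq_add_1\<close>.\<close>

lemmas definable_add_eq = definable_eq[OF definable_trm_add]

lemmas definable_intros =
  definable_not definable_imp definable_disj definable_conj definable_add_eq definable_eq_0
  definable_eq_add_1 definable_tape definable_cell definable_trm_var definable_trm_add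

lemma definable_const: "definable (\<lambda>G e. b)"
proof (cases b)
  case True
  then have "expresses (Neg Bot) (\<lambda>G e. b)" by (simp add: expresses_def)
  then show ?thesis by (auto simp: definable_def)
next
  case False
  then have "expresses Bot (\<lambda>G e. b)" by (simp add: expresses_def)
  then show ?thesis by (auto simp: definable_def)
qed

lemma definable_ball_less:
  fixes n :: nat
  assumes "\<And>i. i < n \<Longrightarrow> definable (P i)"
  shows "definable (\<lambda>G e. \<forall>i\<in>{..<n}. P i G e)"
  using assms
proof (induction n)
  case 0
  then show ?case using definable_const[of True] by simp
next
  case (Suc n)
  then have "definable (\<lambda>G e. P n G e \<and> (\<forall>i\<in>{..<n}. P i G e))"
    by (intro definable_conj) auto
  then show ?case by (simp add: lessThan_Suc)
qed

text \<open>A list of length \<open>m\<close> becomes a block of \<open>m\<close> real variables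
  starting at \<open>b\<close>; the induction splits off the last one.\<close>

lemma definable_ex_list:
  assumes "definable P"
  shows "definable (\<lambda>G e. \<exists>zs. length zs = m \<and> P G (assign b zs e))"
  using assms
proof (induction m arbitrary: P)
  case 0
  then show ?case by simp
next
  case (Suc m)
  have "definable (\<lambda>G e. \<exists>a. P G (e(b + m := a)))"
    by (rule definable_ex[where x = "b + m"]) (use Suc.prems in auto)
  from Suc.IH[OF this]
  have "definable (\<lambda>G e. \<exists>zs. length zs = m \<and> (\<exists>a. P G ((assign b zs e)(b + m := a))))" .
  also have "(\<lambda>G e. \<exists>zs. length zs = m \<and> (\<exists>a. P G ((assign b zs e)(b + m := a)))) =
    (\<lambda>G e. \<exists>zs. length zs = Suc m \<and> P G (assign b zs e))"
    by (simp add: fun_eq_iff length_Suc_conv_rev) (metis assign_snoc)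
  finally show ?case .
qed

text \<open>\<open>represents\<close> quantifies only over reals and over lists whose length is
  fixed by \<open>h\<close>. Arguments and result are variables, and conditions on the arity are
  settled while the formula is built.\<close>

lemma definable_represents: "definable (\<lambda>G e. represents G h (map e is) (e y))"
proof (induction h arbitrary: "is" y)
  case Zero
  then show ?case by (auto intro: definable_intros)
next
  case Succ
  show ?case
  proof (cases "length is = 1")
    case True
    then obtain i where "is = [i]" by (auto simp: length_Suc_conv)
    then show ?thesis by (auto intro: definable_intros)
  qed (simp add: definable_const)
next
  case (Proj i)
  then show ?case
    by (cases "i < length is") (auto intro: definable_eq definable_trm_var definable_const)
next
  case (Comp f gs)
  \<comment> \<open>\<open>b\<close> exceeds all variables in use, so those from \<open>b\<close> on
    can carry the intermediate values.\<close>
  obtain b where b: "\<And>i. i \<in> set (y # is) \<Longrightarrow> i < b"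
    by (meson finite_set finite_nat_set_iff_bounded)
  let ?m = "length gs"
  let ?P = "\<lambda>G e. (\<forall>i\<in>{..<?m}. represents G (gs ! i) (map e is) (e (b + i))) \<and>
    represents G f (map e [b..<b + ?m]) (e y)"
  have "definable ?P"
    using Comp.IH by (intro definable_conj definable_ball_less) auto
  from definable_ex_list[OF this, of ?m b] show ?case
  proof (rule back_subst[of definable], intro ext)
    fix G and e :: "nat \<Rightarrow> real"
    have "?P G (assign b zs e) \<longleftrightarrow>
      (\<forall>i\<in>{..<?m}. represents G (gs ! i) (map e is) (zs ! i)) \<and> represents G f zs (e y)"
      if "length zs = ?m" for zs
    proof -
      have "map (assign b zs e) is = map e is" "assign b zs e y = e y"
        using b by (fastforce simp: assign_def)+
      moreover have "map (assign b zs e) [b..<b + ?m] = zs"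
        "\<forall>i\<in>{..<?m}. assign b zs e (b + i) = zs ! i"
        using that by (auto simp: assign_def intro: nth_equalityI)
      ultimately show ?thesis by (simp del: map_eq_conv)
    qed
    then show "(\<exists>zs. length zs = ?m \<and> ?P G (assign b zs e))
        \<longleftrightarrow> represents G (Comp f gs) (map e is) (e y)"
      unfolding represents.simps by blast
  qed
next
  case (PrimRec f g)
  show ?case
  proof (cases "is")
    case Nil
    then show ?thesis using definable_const[of False] by simp
  next
    case (Cons k ks)
    obtain b where b: "\<And>i. i \<in> set (y # is) \<Longrightarrow> i < b"
      by (meson finite_set finite_nat_set_iff_bounded)
    have fresh: "y \<noteq> b + n" "b + n \<noteq> y" "k \<noteq> b + n" "b + n \<noteq> k" "b + n \<notin> set ks" for n
      using b[of y] b[of k] b[of "b + n"] Cons by auto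
    have f: "definable (\<lambda>G e. represents G f (map e ks) (e (b + 3)))"
      using PrimRec.IH(1) .
    have g: "definable (\<lambda>G e. represents G g (e (b + 4) # e (b + 5) # map e ks) (e (b + 3)))"
      using PrimRec.IH(2)[of "(b + 4) # (b + 5) # ks" "b + 3"] by simp
    \<comment> \<open>The variables \<open>b\<close> to \<open>b + 5\<close> carry \<open>s\<close>,
      \<open>i\<close>, \<open>d\<close>, \<open>u\<close>, \<open>j\<close>, \<open>w\<close> in
      this order.\<close>
    have "definable (\<lambda>G e. \<exists>s. cell G s \<and> G (s + e k) (e y) \<and>
        (\<forall>i d u. cell G i \<and> cell G d \<and> i + d = e k \<and> G (s + i) u \<longrightarrow>
           i = 0 \<and> represents G f (map e ks) u \<or>
           (\<exists>j w. cell G j \<and> i = j + 1 \<and> G (s + j) w \<and> represents G g (j # w # map e ks) u)))"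
      apply (rule definable_ex[where x = "b + 0"])
       apply (intro definable_intros)
       apply (rule definable_all[where x = "b + 1"])
        apply (rule definable_all[where x = "b + 2"])
         apply (rule definable_all[where x = "b + 3"])
          apply (intro definable_intros f)
          apply (rule definable_ex[where x = "b + 4"])
           apply (rule definable_ex[where x = "b + 5"])
            apply (intro definable_intros g)
      using fresh fresh[of 0] fresh[of 1] fresh[of 2] by simp_all
    then show ?thesis using Cons by simp
  qed
next
  case (Mu f)
  obtain b where b: "\<And>i. i \<in> set (y # is) \<Longrightarrow> i < b"
    by (meson finite_set finite_nat_set_iff_bounded)
  have fresh: "y \<noteq> b + n" "b + n \<noteq> y" "b + n \<notin> set is" for n
    using b[of y] b[of "b + n"] by auto
  have f1: "definable (\<lambda>G e. represents G f (e y # map e is) (e (b + 3)))"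
    using Mu.IH[of "y # is" "b + 3"] by simp
  have f2: "definable (\<lambda>G e. represents G f (e (b + 1) # map e is) (e (b + 3)))"
    using Mu.IH[of "(b + 1) # is" "b + 3"] by simp
  \<comment> \<open>The induction hypothesis needs a variable as result, so the result 0 becomes a
    quantified \<open>v\<close> with \<open>v = 0\<close>.\<close>
  have "definable (\<lambda>G e. cell G (e y) \<and> (\<exists>v. v = 0 \<and> represents G f (e y # map e is) v) \<and>
     (\<forall>z d. cell G z \<and> cell G d \<and> z + d = e y \<and> d \<noteq> 0 \<longrightarrow>
        (\<exists>v. v \<noteq> 0 \<and> represents G f (z # map e is) v)))"
    apply (intro definable_conj)
      apply (intro definable_intros)
     apply (rule definable_ex[where x = "b + 3"])
      apply (intro definable_intros f1)
     prefer 2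
     apply (rule definable_all[where x = "b + 1"])
      apply (rule definable_all[where x = "b + 2"])
       apply (intro definable_intros)
       apply (rule definable_ex[where x = "b + 3"])
        apply (intro definable_intros f2)
    using fresh fresh[of 1] fresh[of 2] by simp_all
  then show ?case by simp
qed

lemma definable_cells_initial: "definable (\<lambda>G e. cells_initial G)"
  unfolding cells_initial_def
  apply (rule definable_all[where x = 0])
   apply (intro definable_intros)
   apply (rule definable_ex[where x = 1])
    apply (intro definable_intros)
  by simp_all

end

section \<open>Diagonalisation\<close>

lemma list_tape_realizable:
  assumes "infinite (UNIV :: 'i set)"
  obtains T :: "'i snapshot" and \<Omega> V
  where "traffic_snapshot N T" "sensor_functions N \<Omega>" "is_view N V" "car_tape \<Omega> T V = list_tape w"
proof -
  obtain c :: "nat \<Rightarrow> 'i" where c: "inj c"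
    using assms infinite_countable_subset by blast
  \<comment> \<open>Entry \<open>i\<close> is stored by a car of its own, \<open>c i\<close>, at
    position \<open>i\<close>; these cars may overlap, which a snapshot admits.\<close>
  define P where "P C \<longleftrightarrow> C \<in> c ` {..<length w}" for C
  \<comment> \<open>All remaining cars have length 1 and start at -2, so they end at -1, left of the
    view.\<close>
  define T where "T = \<lparr>res = \<lambda>_. {0}, clm = \<lambda>_. {},
    pos = \<lambda>C. if P C then real (inv c C) else -2, spd = \<lambda>_ :: 'i. 0, acc = \<lambda>_. 0\<rparr>"
  define \<Omega> :: "'i sensors" where "\<Omega> E C T = (if P C then real (w ! inv c C) + 1 else 1)" for E C T
  \<comment> \<open>\<open>sum_list w\<close> bounds every entry, so each storing car ends inside
    the view.\<close>
  define V where "V = \<lparr>lanes = {0}, left = 0, right = real (length w + sum_list w + 1), owner = c 0\<rparr>"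
  have bound: "real i + real (w ! i) + 1 \<le> right V" if "i < length w" for i
    using that elem_le_sum_list[of i w] by (simp add: V_def)
  have covers: "covers \<Omega> T V C a b \<longleftrightarrow> a < b \<and> pos T C \<le> a \<and> b \<le> pos T C + \<Omega> (owner V) C T" for C a b
    by (auto simp: covers_def V_def T_def)
  have car: "P (c i)" "pos T (c i) = real i" "\<Omega> E (c i) T = real (w ! i) + 1" if "i < length w" for i E
    using that c by (auto simp: P_def T_def \<Omega>_def)
  have other: "pos T C + \<Omega> E C T = -1" if "\<not> P C" for C E
    using that by (auto simp: T_def \<Omega>_def)
  have "car_tape \<Omega> T V s v \<longleftrightarrow> list_tape w s v" for s v
  proof
    assume "car_tape \<Omega> T V s v"
    then obtain C p q where *: "0 \<le> p" "p \<le> q" "q \<le> right V" "p = s" "q - p = v + 1"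
      "covers \<Omega> T V C p q" "\<And>r. 0 \<le> r \<and> r \<le> p \<longrightarrow> \<not> covers \<Omega> T V C r p"
      "\<And>r. q \<le> r \<and> r \<le> right V \<longrightarrow> \<not> covers \<Omega> T V C q r"
      unfolding car_tape_def by (auto simp: V_def)
    have "P C"
      using *(1,2,6) other[of C "owner V"] by (cases "P C") (auto simp: covers)
    then obtain i where i: "C = c i" "i < length w" by (auto simp: P_def)
    \<comment> \<open>Were the covered part shorter than the car, the car would cover an adjacent
      piece inside the view, against maximality.\<close>
    have "p = real i" "q = real i + real (w ! i) + 1"
      using *(2,3,6) *(7)[of "real i"] *(8)[of "real i + real (w ! i) + 1"] bound[OF i(2)]
      by (auto simp: covers i car)
    with * i show "list_tape w s v" by (auto simp: list_tape_def)
  next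
    assume "list_tape w s v"
    then obtain i where i: "i < length w" "s = real i" "v = real (w ! i)"
      by (auto simp: list_tape_def)
    then show "car_tape \<Omega> T V s v"
      unfolding car_tape_def covers
      by (intro exI[of _ "c i"] exI[of _ "real i"] exI[of _ "real i + real (w ! i) + 1"])
        (use bound in \<open>auto simp: car V_def\<close>)
  qed
  moreover have "traffic_snapshot N T"
    by (simp add: traffic_snapshot_def T_def)
  moreover have "sensor_functions N \<Omega>"
    by (auto simp: sensor_functions_def \<Omega>_def)
  moreover have "is_view N V"
    by (auto simp: is_view_def V_def discrete_interval_def intro!: exI[of _ 0])
  ultimately show thesis using that[of T \<Omega> V] by blast
qed

section \<open>Recursive functions on codes of formulas\<close>

lemma computes_Comp1:
  "computes g xs a \<Longrightarrow> computes f [a] y \<Longrightarrow> computes (Comp f [g]) xs y"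
  by (rule computes_Comp[of "[a]"]) auto

lemma computes_Comp2:
  "computes g xs a \<Longrightarrow> computes h xs b \<Longrightarrow> computes f [a, b] y \<Longrightarrow> computes (Comp f [g, h]) xs y"
  by (rule computes_Comp[of "[a, b]"]) (auto simp: less_Suc_eq)

lemma computes_Proj_0: "computes (Proj 0) (x # xs) x"
  using computes_Proj[of 0 "x # xs"] by simp

lemma computes_Proj_1: "computes (Proj 1) (x # y # xs) y"
  using computes_Proj[of 1 "x # y # xs"] by simp

fun const_recf :: "nat \<Rightarrow> recf" where
  "const_recf 0 = Zero"
| "const_recf (Suc n) = Comp Succ [const_recf n]"

lemma computes_const: "computes (const_recf n) xs n"
  by (induction n) (auto intro: computes_Zero computes_Succ computes_Comp1)

definition add_recf :: recf where
  "add_recf = PrimRec (Proj 0) (Comp Succ [Proj 1])"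

lemma computes_add: "computes add_recf [m, n] (m + n)"
  unfolding add_recf_def
proof (induction m)
  case 0
  show ?case using computes_Proj_0 by (auto intro: computes_PrimRec_0)
next
  case (Suc m)
  show ?case
    by (rule computes_PrimRec_Suc[OF Suc])
      (simp add: computes_Comp1[OF computes_Proj_1 computes_Succ] del: One_nat_def)
qed

definition triangle_recf :: recf where
  "triangle_recf = PrimRec Zero (Comp add_recf [Proj 1, Comp Succ [Proj 0]])"

lemma computes_triangle: "computes triangle_recf [n] (triangle n)"
  unfolding triangle_recf_def
proof (induction n)
  case 0
  show ?case using computes_Zero by (auto intro: computes_PrimRec_0)
next
  case (Suc n)
  have "computes (Comp add_recf [Proj 1, Comp Succ [Proj 0]]) [n, triangle n] (triangle n + Suc n)"
    by (intro computes_Comp2[OF computes_Proj_1 _ computes_add]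
        computes_Comp1[OF computes_Proj_0 computes_Succ])
  then show ?case using computes_PrimRec_Suc[OF Suc] by simp
qed

text \<open>Implements Cantor pairing,
  \<open>prod_encode (a, b) = triangle (a + b) + a\<close>.\<close>

definition pair_recf :: "recf \<Rightarrow> recf \<Rightarrow> recf" where
  "pair_recf g h = Comp (Comp add_recf [Comp triangle_recf [add_recf], Proj 0]) [g, h]"

lemma computes_pair:
  assumes "computes g xs a" "computes h xs b"
  shows "computes (pair_recf g h) xs (prod_encode (a, b))"
  unfolding pair_recf_def prod_encode_def prod.case
  by (intro computes_Comp2[OF assms] computes_Comp2[OF _ _ computes_add] computes_Proj_0
      computes_Comp1[OF computes_add computes_triangle])

text \<open>5 is the tag of \<open>Plus\<close> and \<open>Proj 1\<close> the code of the previous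
  numeral; \<open>Zero\<close> is the right start because \<open>LaneConst 0\<close> has code
  0.\<close>

definition numeral_recf :: recf where
  "numeral_recf = PrimRec Zero
     (pair_recf (const_recf 5) (pair_recf (Proj 1) (const_recf (code_trm (LaneConst 1)))))"

lemma computes_numeral: "computes numeral_recf [n] (code_trm (numeral_trm n))"
  unfolding numeral_recf_def
proof (induction n)
  case 0
  have "code_trm (numeral_trm 0) = 0" by (simp add: prod_encode_def)
  then show ?case using computes_Zero by (auto intro: computes_PrimRec_0)
next
  case (Suc n)
  show ?case
    unfolding numeral_trm.simps code_trm.simps(6)
    by (intro computes_PrimRec_Suc[OF Suc] computes_pair computes_const computes_Proj_1)
qed

text \<open>Says that variable 0 is the code of \<phi> and that \<phi> fails. Equating the variable
  replaces substitution, so the new code arises from the old one by pairing and a numeral.\<close>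

definition diagonal :: "nat fm \<Rightarrow> nat fm" where
  "diagonal \<phi> = Neg (Imp (Eq (Sym (Var RealSort 0)) (numeral_trm (code_fm \<phi>))) \<phi>)"

definition diagonal_recf :: recf where
  "diagonal_recf =
     pair_recf (const_recf 4) (pair_recf
       (pair_recf (const_recf 4) (pair_recf
          (pair_recf (const_recf 1) (pair_recf
             (const_recf (code_trm (Sym (Var RealSort 0)))) numeral_recf))
          (Proj 0)))
       (const_recf (code_fm Bot)))"

lemma computes_diagonal: "computes diagonal_recf [code_fm \<phi>] (code_fm (diagonal \<phi>))"
  unfolding diagonal_recf_def diagonal_def code_fm.simps(2,5)
  by (intro computes_pair computes_const computes_numeral computes_Proj_0)

theorem theorem3p2:
  fixes N :: nat and \<rho> :: "nat \<Rightarrow> real"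
  assumes "countable (UNIV :: 'i set)" and "infinite (UNIV :: 'i set)"
    and "1 \<le> N"
  shows "\<not> (\<exists>f. \<forall>\<phi> :: nat fm. wf_fm N \<phi> \<longrightarrow>
              computes f [code_fm \<phi>] (if satisfiable TYPE('i) N (map_fm \<rho> \<phi>) then 1 else 0))"
proof
  assume "\<exists>f. \<forall>\<phi> :: nat fm. wf_fm N \<phi> \<longrightarrow>
    computes f [code_fm \<phi>] (if satisfiable TYPE('i) N (map_fm \<rho> \<phi>) then 1 else 0)"
  then obtain f where f: "\<And>\<phi> :: nat fm. wf_fm N \<phi> \<Longrightarrow>
    computes f [code_fm \<phi>] (if satisfiable TYPE('i) N (map_fm \<rho> \<phi>) then 1 else 0)"
    by blast
  interpret real_notation "TYPE('i)" N \<rho>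
    by unfold_locales (rule assms(3))
  \<comment> \<open>On the code of a formula, \<open>g\<close> returns the verdict of
    \<open>f\<close> on its diagonal formula.\<close>
  define g where "g = Comp f [diagonal_recf]"
  have "definable (\<lambda>G e. \<exists>y. y = 0 \<and> represents G g [e 0] y)"
    by (rule definable_ex[where x = 1])
      (use definable_represents[of g "[0]" 1] in \<open>auto intro!: definable_conj definable_eq_0 definable_trm_var\<close>)
  then have "definable (\<lambda>G e. \<not> (cells_initial G \<and> represents G g [e 0] 0))"
    using definable_cells_initial by (intro definable_not definable_conj) simp_all
  \<comment> \<open>The negation cancels against the one in \<open>diagonal\<close>:
    \<open>?\<psi>\<close> asserts that the tape represents \<open>g\<close> mapping
    \<open>?d\<close> to 0.\<close>
  then obtain \<phi> where \<phi>: "expresses \<phi> (\<lambda>G e. \<not> (cells_initial G \<and> represents G g [e 0] 0))"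
    by (auto simp: definable_def)
  let ?d = "code_fm \<phi>" and ?\<psi> = "diagonal \<phi>"
  have wf: "wf_fm N ?\<psi>"
    using \<phi> wf_numeral_trm[OF assms(3)] by (simp add: diagonal_def expresses_def)
  have models: "models N \<Omega> T V \<nu> (map_fm \<rho> ?\<psi>) \<longleftrightarrow>
      reals_of \<nu> 0 = real ?d \<and> cells_initial (car_tape \<Omega> T V) \<and>
      represents (car_tape \<Omega> T V) g [reals_of \<nu> 0] 0"
    if "sort_respecting N \<nu>" for \<Omega> T \<nu> and V :: "'i view"
    using \<phi> that by (auto simp: diagonal_def expresses_def sort_respecting_real)
  have "satisfiable TYPE('i) N (map_fm \<rho> ?\<psi>) \<longleftrightarrow> computes g [?d] 0"
  proof
    assume "satisfiable TYPE('i) N (map_fm \<rho> ?\<psi>)"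
    then obtain T \<Omega> and V :: "'i view" where
      "cells_initial (car_tape \<Omega> T V)" "represents (car_tape \<Omega> T V) g (map real [?d]) 0"
      unfolding satisfiable_def using models by auto
    then have "\<exists>m. 0 = real m \<and> computes g [?d] m"
      by (intro represents_imp_computes[where G = "car_tape \<Omega> T V"] cell_car_tape_nonneg)
    then show "computes g [?d] 0" by auto
  next
    assume "computes g [?d] 0"
    then obtain w where w: "represents (list_tape w) g [real ?d] 0"
      using computes_imp_represents[of g "[?d]" 0] by fastforce
    obtain T :: "'i snapshot" and \<Omega> V where real:
      "traffic_snapshot N T" "sensor_functions N \<Omega>" "is_view N V" "car_tape \<Omega> T V = list_tape w"
      using list_tape_realizable[OF assms(2)] by blast
    define \<nu> where "\<nu> c = (case c of Ego \<Rightarrow> CarVal (owner V) | Var s x \<Rightarrow>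
      (case s of CarSort \<Rightarrow> CarVal (owner V) | RealSort \<Rightarrow> NumVal (real ?d) | LaneSort \<Rightarrow> NumVal 0))" for c
    have "sort_respecting N \<nu>"
      by (auto simp: sort_respecting_def \<nu>_def image_iff split: sym.split srt.split intro!: bexI[of _ 0])
    moreover have "reals_of \<nu> 0 = real ?d" "\<nu> Ego = CarVal (owner V)"
      by (auto simp: reals_of_def \<nu>_def)
    ultimately show "satisfiable TYPE('i) N (map_fm \<rho> ?\<psi>)"
      unfolding satisfiable_def using real w models cells_initial_list_tape by metis
  qed
  \<comment> \<open>The verdict of \<open>f\<close> is 0 only if \<open>?\<psi>\<close> is
    unsatisfiable, whereas by the equivalence \<open>g\<close> yields 0 iff \<open>?\<psi>\<close>
    is satisfiable; determinism gives the contradiction.\<close>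
  moreover have "computes g [?d] (if satisfiable TYPE('i) N (map_fm \<rho> ?\<psi>) then 1 else 0)"
    unfolding g_def by (rule computes_Comp1[OF computes_diagonal f[OF wf]])
  ultimately show False
    using computes_deterministic by (metis zero_neq_one)
qed

end
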